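(* Let $(\Sigma,\mathcal H)$ be the quasi-equational theory of right-preordered groups described in the context. There is an equivalence of categories $$\mathrm{Alg}(\Sigma,\mathcal H)\simeq \mathbf{RPOGrp}$$ between the category of models of $(\Sigma,\mathcal H)$ in sets (with maps preserving all operations as morphisms) and the category of right-preordered groups.
   Context: Groups are written additively and need not be abelian. A right-preordered group is a group $G$ with a preorder $\le$ such that $g\le h$ implies $g+k\le h+k$ for all $g,h,k\in G$. Equivalently, it is a pair $(G,P_G)$ where $G$ is a group and $P_G$ is a submonoid of $G$ (the positive cone; $P_G=\{g\mid 0\le g\}$ and $g\le h$ iff $h-g\in P_G$). The category $\mathbf{RPOGrp}$ has these as objects, and as morphisms $(G,P_G)\to(H,P_H)$ the group homomorphisms $f:G\to H$ with $f(P_G)\subseteq P_H$. The signature $\Sigma$ has one constant $0$, four unary operations $\iota,\pi_0,\pi_1,-$ and one binary operation $+$. Write $a_i$ for $\pi_i(a)$ ($i=0,1$) and $a-b$ for $a+(-b)$. The axioms $\mathcal H$ (all variables universally quantified) are: (M) $(0,+)$ satisfies the axioms of monoids, and each $f\in\{\pi_0,\pi_1,\iota\}$ satisfies $f(a)+f(b)=f(a+b)$ and $f(0)=0$; (P1) $a=a_0+a_1=a_1+a_0$; (P2) $-(a_1)=0$, $(\iota(a))_1=0$, $(a_1)_0=0$, $(a_0)_1=0$; (P3) $\iota(a_1)=(\iota(a))_0$; (G) $a-a=-a+a=a_1$ (that is, $a+(-a)=(-a)+a=a_1$); (Inj) $\iota(a)=\iota(b)\Rightarrow a_1=b_1$.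 *)

theory Defs
  imports "HOL-Algebra.Group"
begin

section \<open>Categories and equivalences of categories\<close>

text \<open>
  Hom-sets are indexed by source and target and need not be disjoint, so identities and composition
  carry the objects involved as arguments: \<open>Comp C a b c g f\<close> is \<open>g \<circ> f\<close> for \<open>f : a \<rightarrow> b\<close> and
  \<open>g : b \<rightarrow> c\<close>.
\<close>

record ('o, 'm) cat =
  Obj :: "'o set"
  Arr :: "'o \<Rightarrow> 'o \<Rightarrow> 'm set"
  Ident :: "'o \<Rightarrow> 'm"
  Comp :: "'o \<Rightarrow> 'o \<Rightarrow> 'o \<Rightarrow> 'm \<Rightarrow> 'm \<Rightarrow> 'm"

locale category =
  fixes C :: "('o, 'm) cat"
  assumes Ident_in: "a \<in> Obj C \<Longrightarrow> Ident C a \<in> Arr C a a"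
    and Comp_in:
      "\<lbrakk>a \<in> Obj C; b \<in> Obj C; c \<in> Obj C; f \<in> Arr C a b; g \<in> Arr C b c\<rbrakk>
        \<Longrightarrow> Comp C a b c g f \<in> Arr C a c"
    and Comp_Ident_left:
      "\<lbrakk>a \<in> Obj C; b \<in> Obj C; f \<in> Arr C a b\<rbrakk> \<Longrightarrow> Comp C a b b (Ident C b) f = f"
    and Comp_Ident_right:
      "\<lbrakk>a \<in> Obj C; b \<in> Obj C; f \<in> Arr C a b\<rbrakk> \<Longrightarrow> Comp C a a b f (Ident C a) = f"
    and Comp_assoc:
      "\<lbrakk>a \<in> Obj C; b \<in> Obj C; c \<in> Obj C; d \<in> Obj C;
        f \<in> Arr C a b; g \<in> Arr C b c; h \<in> Arr C c d\<rbrakk>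
        \<Longrightarrow> Comp C a c d h (Comp C a b c g f) = Comp C a b d (Comp C b c d h g) f"

locale cat_functor = source: category C + target: category D
  for C :: "('o1, 'm1) cat" and D :: "('o2, 'm2) cat" +
  fixes Fo :: "'o1 \<Rightarrow> 'o2" and Fm :: "'o1 \<Rightarrow> 'o1 \<Rightarrow> 'm1 \<Rightarrow> 'm2"
  assumes Fo_in: "a \<in> Obj C \<Longrightarrow> Fo a \<in> Obj D"
    and Fm_in:
      "\<lbrakk>a \<in> Obj C; b \<in> Obj C; f \<in> Arr C a b\<rbrakk> \<Longrightarrow> Fm a b f \<in> Arr D (Fo a) (Fo b)"
    and Fm_Ident: "a \<in> Obj C \<Longrightarrow> Fm a a (Ident C a) = Ident D (Fo a)"
    and Fm_Comp:
      "\<lbrakk>a \<in> Obj C; b \<in> Obj C; c \<in> Obj C; f \<in> Arr C a b; g \<in> Arr C b c\<rbrakk>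
        \<Longrightarrow> Fm a c (Comp C a b c g f) = Comp D (Fo a) (Fo b) (Fo c) (Fm b c g) (Fm a b f)"

definition iso_arr :: "('o, 'm) cat \<Rightarrow> 'o \<Rightarrow> 'o \<Rightarrow> 'm \<Rightarrow> bool" where
  "iso_arr C a b f \<longleftrightarrow> f \<in> Arr C a b \<and>
     (\<exists>g \<in> Arr C b a. Comp C a b a g f = Ident C a \<and> Comp C b a b f g = Ident C b)"

definition natural_iso ::
  "('o1, 'm1) cat \<Rightarrow> ('o2, 'm2) cat
    \<Rightarrow> ('o1 \<Rightarrow> 'o2) \<Rightarrow> ('o1 \<Rightarrow> 'o1 \<Rightarrow> 'm1 \<Rightarrow> 'm2)
    \<Rightarrow> ('o1 \<Rightarrow> 'o2) \<Rightarrow> ('o1 \<Rightarrow> 'o1 \<Rightarrow> 'm1 \<Rightarrow> 'm2)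
    \<Rightarrow> ('o1 \<Rightarrow> 'm2) \<Rightarrow> bool" where
  "natural_iso C D Fo Fm Go Gm \<eta> \<longleftrightarrow>
     (\<forall>a \<in> Obj C. iso_arr D (Fo a) (Go a) (\<eta> a)) \<and>
     (\<forall>a \<in> Obj C. \<forall>b \<in> Obj C. \<forall>f \<in> Arr C a b.
        Comp D (Fo a) (Fo b) (Go b) (\<eta> b) (Fm a b f)
        = Comp D (Fo a) (Go a) (Go b) (Gm a b f) (\<eta> a))"

definition equivalent_categories :: "('o1, 'm1) cat \<Rightarrow> ('o2, 'm2) cat \<Rightarrow> bool" where
  "equivalent_categories C D \<longleftrightarrow> category C \<and> category D \<and>
     (\<exists>Fo Fm Go Gm \<eta> \<epsilon>.
        cat_functor C D Fo Fm \<and> cat_functor D C Go Gm \<and>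
        natural_iso C C (\<lambda>a. Go (Fo a)) (\<lambda>a b f. Gm (Fo a) (Fo b) (Fm a b f))
          (\<lambda>a. a) (\<lambda>a b f. f) \<eta> \<and>
        natural_iso D D (\<lambda>x. Fo (Go x)) (\<lambda>x y u. Fm (Go x) (Go y) (Gm x y u))
          (\<lambda>x. x) (\<lambda>x y u. u) \<epsilon>)"


section \<open>Quasi-equational theories and their models\<close>

datatype 'f trm = Var nat | Fn 'f "'f trm list"

datatype 'f quasi_eq =
  Quasi_Eq (hypotheses: "('f trm \<times> 'f trm) list") (consequent: "'f trm \<times> 'f trm")

fun wf_trm :: "('f \<Rightarrow> nat) \<Rightarrow> 'f trm \<Rightarrow> bool" where
  "wf_trm ar (Var n) = True"
| "wf_trm ar (Fn f ts) = (length ts = ar f \<and> (\<forall>t \<in> set ts. wf_trm ar t))"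

definition quasi_equational_theory :: "('f \<Rightarrow> nat) \<Rightarrow> 'f quasi_eq set \<Rightarrow> bool" where
  "quasi_equational_theory ar H \<longleftrightarrow>
     (\<forall>q \<in> H. \<forall>(s, t) \<in> insert (consequent q) (set (hypotheses q)). wf_trm ar s \<and> wf_trm ar t)"

text \<open>
  As for the records of HOL-Algebra, the values of \<open>interp\<close> outside the carrier (or on argument
  lists of the wrong length) are irrelevant.
\<close>

record ('f, 'a) algebra = "'a partial_object" +
  interp :: "'f \<Rightarrow> 'a list \<Rightarrow> 'a"

definition algebra_of :: "('f \<Rightarrow> nat) \<Rightarrow> ('f, 'a) algebra \<Rightarrow> bool" where
  "algebra_of ar A \<longleftrightarrow>
     (\<forall>f xs. length xs = ar f \<longrightarrow> set xs \<subseteq> carrier A \<longrightarrow> interp A f xs \<in> carrier A)"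

fun eval_trm :: "('f, 'a) algebra \<Rightarrow> (nat \<Rightarrow> 'a) \<Rightarrow> 'f trm \<Rightarrow> 'a" where
  "eval_trm A v (Var n) = v n"
| "eval_trm A v (Fn f ts) = interp A f (map (eval_trm A v) ts)"

definition satisfies_eq :: "('f, 'a) algebra \<Rightarrow> (nat \<Rightarrow> 'a) \<Rightarrow> 'f trm \<times> 'f trm \<Rightarrow> bool" where
  "satisfies_eq A v e \<longleftrightarrow> eval_trm A v (fst e) = eval_trm A v (snd e)"

definition satisfies :: "('f, 'a) algebra \<Rightarrow> 'f quasi_eq \<Rightarrow> bool" where
  "satisfies A q \<longleftrightarrow>
     (\<forall>v. range v \<subseteq> carrier A \<longrightarrow> (\<forall>e \<in> set (hypotheses q). satisfies_eq A v e)
        \<longrightarrow> satisfies_eq A v (consequent q))"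

text \<open>
  Arrows are extensional functions on the carrier, so that equality of arrows is equality of maps
  between the carriers. The type \<open>'a\<close> plays the role of the universe: models in sets are models
  whose carrier is a subset of \<open>'a\<close>. The same convention applies to right-preordered groups.
\<close>

definition algebra_hom ::
  "('f \<Rightarrow> nat) \<Rightarrow> ('f, 'a) algebra \<Rightarrow> ('f, 'b) algebra \<Rightarrow> ('a \<Rightarrow> 'b) set" where
  "algebra_hom ar A B =
     {h \<in> carrier A \<rightarrow>\<^sub>E carrier B.
        \<forall>f xs. length xs = ar f \<longrightarrow> set xs \<subseteq> carrier A
          \<longrightarrow> h (interp A f xs) = interp B f (map h xs)}"

definition Alg ::
  "('f \<Rightarrow> nat) \<Rightarrow> 'f quasi_eq set \<Rightarrow> (('f, 'a) algebra, 'a \<Rightarrow> 'a) cat" where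
  "Alg ar H =
     \<lparr>Obj = {A. algebra_of ar A \<and> (\<forall>q \<in> H. satisfies A q)},
      Arr = algebra_hom ar,
      Ident = (\<lambda>A. \<lambda>x \<in> carrier A. x),
      Comp = (\<lambda>A B C g f. compose (carrier A) g f)\<rparr>"


section \<open>The theory of right-preordered groups\<close>

datatype rpo_op = Zero | Iota | Pi0 | Pi1 | Neg | Plus

fun rpo_arity :: "rpo_op \<Rightarrow> nat" where
  "rpo_arity Zero = 0"
| "rpo_arity Iota = 1"
| "rpo_arity Pi0 = 1"
| "rpo_arity Pi1 = 1"
| "rpo_arity Neg = 1"
| "rpo_arity Plus = 2"

abbreviation zero_t :: "rpo_op trm" where "zero_t \<equiv> Fn Zero []"
abbreviation iota_t :: "rpo_op trm \<Rightarrow> rpo_op trm" where "iota_t s \<equiv> Fn Iota [s]"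
abbreviation pi0_t :: "rpo_op trm \<Rightarrow> rpo_op trm" where "pi0_t s \<equiv> Fn Pi0 [s]"
abbreviation pi1_t :: "rpo_op trm \<Rightarrow> rpo_op trm" where "pi1_t s \<equiv> Fn Pi1 [s]"
abbreviation neg_t :: "rpo_op trm \<Rightarrow> rpo_op trm" where "neg_t s \<equiv> Fn Neg [s]"
abbreviation plus_t :: "rpo_op trm \<Rightarrow> rpo_op trm \<Rightarrow> rpo_op trm" (infixl "[+]" 65)
  where "s [+] t \<equiv> Fn Plus [s, t]"
abbreviation equation :: "'f trm \<Rightarrow> 'f trm \<Rightarrow> 'f quasi_eq" (infix "[=]" 50)
  where "s [=] t \<equiv> Quasi_Eq [] (s, t)"

abbreviation (input) var_a :: "rpo_op trm" where "var_a \<equiv> Var 0"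
abbreviation (input) var_b :: "rpo_op trm" where "var_b \<equiv> Var 1"
abbreviation (input) var_c :: "rpo_op trm" where "var_c \<equiv> Var 2"

definition axioms_M :: "rpo_op quasi_eq set" where
  "axioms_M =
     {(var_a [+] var_b) [+] var_c [=] var_a [+] (var_b [+] var_c),
      zero_t [+] var_a [=] var_a,
      var_a [+] zero_t [=] var_a}
     \<union> (\<Union>f \<in> {Pi0, Pi1, Iota}.
          {Fn f [var_a] [+] Fn f [var_b] [=] Fn f [var_a [+] var_b],
           Fn f [zero_t] [=] zero_t})"

definition axioms_P1 :: "rpo_op quasi_eq set" where
  "axioms_P1 =
     {var_a [=] pi0_t var_a [+] pi1_t var_a,
      pi0_t var_a [+] pi1_t var_a [=] pi1_t var_a [+] pi0_t var_a}"

definition axioms_P2 :: "rpo_op quasi_eq set" where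
  "axioms_P2 =
     {neg_t (pi1_t var_a) [=] zero_t,
      pi1_t (iota_t var_a) [=] zero_t,
      pi0_t (pi1_t var_a) [=] zero_t,
      pi1_t (pi0_t var_a) [=] zero_t}"

definition axioms_P3 :: "rpo_op quasi_eq set" where
  "axioms_P3 = {iota_t (pi1_t var_a) [=] pi0_t (iota_t var_a)}"

definition axioms_G :: "rpo_op quasi_eq set" where
  "axioms_G =
     {var_a [+] neg_t var_a [=] neg_t var_a [+] var_a,
      neg_t var_a [+] var_a [=] pi1_t var_a}"

definition axioms_Inj :: "rpo_op quasi_eq set" where
  "axioms_Inj =
     {Quasi_Eq [(iota_t var_a, iota_t var_b)] (pi1_t var_a, pi1_t var_b)}"

definition rpo_axioms :: "rpo_op quasi_eq set" where
  "rpo_axioms = axioms_M \<union> axioms_P1 \<union> axioms_P2 \<union> axioms_P3 \<union> axioms_G \<union> axioms_Inj"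

lemma quasi_equational_theory_rpo: "quasi_equational_theory rpo_arity rpo_axioms"
  by (auto simp: quasi_equational_theory_def rpo_axioms_def axioms_M_def axioms_P1_def
      axioms_P2_def axioms_P3_def axioms_G_def axioms_Inj_def)


section \<open>Right-preordered groups\<close>

text \<open>
  HOL-Algebra writes groups multiplicatively; \<open>pos_cone G\<close> is the positive cone. The preorder is
  recovered by \<open>cone_rel\<close> below.
\<close>

record 'a rpogroup = "'a monoid" +
  pos_cone :: "'a set"

locale right_preordered_group = group G + submonoid "pos_cone G" G
  for G :: "'a rpogroup" (structure)

definition rpo_hom :: "'a rpogroup \<Rightarrow> 'b rpogroup \<Rightarrow> ('a \<Rightarrow> 'b) set" where
  "rpo_hom G H =
     {f \<in> hom G H. f \<in> extensional (carrier G) \<and> f ` pos_cone G \<subseteq> pos_cone H}"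

definition RPOGrp :: "('a rpogroup, 'a \<Rightarrow> 'a) cat" where
  "RPOGrp =
     \<lparr>Obj = {G. right_preordered_group G},
      Arr = rpo_hom,
      Ident = (\<lambda>G. \<lambda>x \<in> carrier G. x),
      Comp = (\<lambda>G H K g f. compose (carrier G) g f)\<rparr>"

text \<open>Positive cones correspond bijectively to right-invariant preorders on the group.\<close>

definition cone_rel :: "('a, 'b) monoid_scheme \<Rightarrow> 'a set \<Rightarrow> ('a \<times> 'a) set" where
  "cone_rel G P = {(g, h). g \<in> carrier G \<and> h \<in> carrier G \<and> h \<otimes>\<^bsub>G\<^esub> inv\<^bsub>G\<^esub> g \<in> P}"

definition right_invariant :: "('a, 'b) monoid_scheme \<Rightarrow> ('a \<times> 'a) set \<Rightarrow> bool" where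
  "right_invariant G R \<longleftrightarrow>
     (\<forall>g h. \<forall>k \<in> carrier G. (g, h) \<in> R \<longrightarrow> (g \<otimes>\<^bsub>G\<^esub> k, h \<otimes>\<^bsub>G\<^esub> k) \<in> R)"

lemma (in group) preorder_of_cone:
  assumes "submonoid P G"
  shows "preorder_on (carrier G) (cone_rel G P)"
    and "right_invariant G (cone_rel G P)"
    and "{g. (\<one>, g) \<in> cone_rel G P} = P"
proof -
  interpret submonoid P G by fact
  show "preorder_on (carrier G) (cone_rel G P)"
    unfolding preorder_on_def
  proof (intro conjI)
    show "cone_rel G P \<subseteq> carrier G \<times> carrier G" "refl_on (carrier G) (cone_rel G P)"
      by (auto simp: cone_rel_def refl_on_def)
    show "trans (cone_rel G P)"
    proof (rule transI)
      fix x y z assume xy: "(x, y) \<in> cone_rel G P" and yz: "(y, z) \<in> cone_rel G P"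
      then have c: "x \<in> carrier G" "y \<in> carrier G" "z \<in> carrier G"
        by (auto simp: cone_rel_def)
      have p: "(z \<otimes> inv y) \<otimes> (y \<otimes> inv x) \<in> P"
        using xy yz by (auto simp: cone_rel_def)
      have "inv y \<otimes> (y \<otimes> inv x) = inv x"
        using c by (simp flip: m_assoc)
      then have "(z \<otimes> inv y) \<otimes> (y \<otimes> inv x) = z \<otimes> inv x"
        using c by (simp add: m_assoc)
      then show "(x, z) \<in> cone_rel G P"
        using c p by (simp add: cone_rel_def)
    qed
  qed
  show "right_invariant G (cone_rel G P)"
    unfolding right_invariant_def
  proof (intro allI ballI impI)
    fix g h k assume k: "k \<in> carrier G" and gh: "(g, h) \<in> cone_rel G P"
    then have c: "g \<in> carrier G" "h \<in> carrier G"
      by (auto simp: cone_rel_def)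
    have "k \<otimes> (inv k \<otimes> inv g) = inv g"
      using c k by (simp flip: m_assoc)
    then have "(h \<otimes> k) \<otimes> inv (g \<otimes> k) = h \<otimes> inv g"
      using c k by (simp add: inv_mult_group m_assoc)
    then show "(g \<otimes> k, h \<otimes> k) \<in> cone_rel G P"
      using c k gh by (simp add: cone_rel_def)
  qed
  show "{g. (\<one>, g) \<in> cone_rel G P} = P"
    using subset by (auto simp: cone_rel_def)
qed

lemma (in group) cone_of_preorder:
  assumes "preorder_on (carrier G) R" and "right_invariant G R"
  shows "submonoid {g. (\<one>, g) \<in> R} G"
    and "cone_rel G {g. (\<one>, g) \<in> R} = R"
proof -
  have sub: "R \<subseteq> carrier G \<times> carrier G" and refl: "refl_on (carrier G) R" and tr: "trans R"
    using assms(1) by (auto simp: preorder_on_def)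
  have inv: "(g \<otimes> k, h \<otimes> k) \<in> R" if "(g, h) \<in> R" "k \<in> carrier G" for g h k
    using assms(2) that by (auto simp: right_invariant_def)
  show "submonoid {g. (\<one>, g) \<in> R} G"
  proof
    show "{g. (\<one>, g) \<in> R} \<subseteq> carrier G" using sub by auto
    show "\<one> \<in> {g. (\<one>, g) \<in> R}" using refl by (auto simp: refl_on_def)
    fix x y assume x: "x \<in> {g. (\<one>, g) \<in> R}" and y: "y \<in> {g. (\<one>, g) \<in> R}"
    then have "y \<in> carrier G" using sub by auto
    then have "(y, x \<otimes> y) \<in> R" using inv[of \<one> x y] x by simp
    then show "x \<otimes> y \<in> {g. (\<one>, g) \<in> R}" using y tr by (auto dest: transD)
  qed
  show "cone_rel G {g. (\<one>, g) \<in> R} = R"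
  proof (intro equalityI subrelI)
    fix g h assume "(g, h) \<in> cone_rel G {g. (\<one>, g) \<in> R}"
    then have c: "g \<in> carrier G" "h \<in> carrier G" and "(\<one>, h \<otimes> inv g) \<in> R"
      by (auto simp: cone_rel_def)
    then have "(\<one> \<otimes> g, h \<otimes> inv g \<otimes> g) \<in> R" using inv by blast
    then show "(g, h) \<in> R" using c by (simp add: m_assoc)
  next
    fix g h assume gh: "(g, h) \<in> R"
    then have c: "g \<in> carrier G" "h \<in> carrier G" using sub by auto
    have "(g \<otimes> inv g, h \<otimes> inv g) \<in> R" using inv gh c by blast
    then show "(g, h) \<in> cone_rel G {g. (\<one>, g) \<in> R}" using c by (simp add: cone_rel_def)
  qed
qed

end

theory Submission
  imports Defs
begin

text \<open>
  In a model, \<open>\<pi>\<^sub>0\<close> and \<open>\<pi>\<^sub>1\<close> split the monoid as a direct product \<open>M\<^sub>0 \<times> M\<^sub>1\<close> with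
  \<open>M\<^sub>0 = ker \<pi>\<^sub>1\<close>. By (G), \<open>M\<^sub>0\<close> is a group, and \<open>\<iota>\<close> vanishes on \<open>M\<^sub>0\<close> and embeds \<open>M\<^sub>1\<close> in \<open>M\<^sub>0\<close>; so
  \<open>(M\<^sub>0, \<iota>(M\<^sub>1))\<close> is a right-preordered group. Conversely, \<open>(G, P)\<close> gives the model \<open>G \<times> P\<close> with
  \<open>\<iota>(g, p) = (p, 0)\<close> and \<open>-(g, p) = (-g, 0)\<close>; the infinite universe is needed to code pairs.
\<close>

section \<open>Categories\<close>

text \<open>The inverses of the components are again natural. This turns the unit round: it is built
  from the identity to the composite, whereas \<open>equivalent_categories\<close> asks for the
  opposite direction.\<close>

lemma natural_iso_sym:
  assumes F: "cat_functor C D Fo Fm" and G: "cat_functor C D Go Gm"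
    and nat: "natural_iso C D Fo Fm Go Gm \<eta>"
  shows "\<exists>\<theta>. natural_iso C D Go Gm Fo Fm \<theta>"
proof -
  interpret F: cat_functor C D Fo Fm by (rule F)
  interpret G: cat_functor C D Go Gm by (rule G)
  have "\<forall>a \<in> Obj C. \<exists>g. g \<in> Arr D (Go a) (Fo a) \<and>
      Comp D (Fo a) (Go a) (Fo a) g (\<eta> a) = Ident D (Fo a) \<and>
      Comp D (Go a) (Fo a) (Go a) (\<eta> a) g = Ident D (Go a)"
    using nat by (auto simp: natural_iso_def iso_arr_def)
  then obtain \<theta> where \<theta>: "\<And>a. a \<in> Obj C \<Longrightarrow> \<theta> a \<in> Arr D (Go a) (Fo a)"
    "\<And>a. a \<in> Obj C \<Longrightarrow> Comp D (Fo a) (Go a) (Fo a) (\<theta> a) (\<eta> a) = Ident D (Fo a)"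
    "\<And>a. a \<in> Obj C \<Longrightarrow> Comp D (Go a) (Fo a) (Go a) (\<eta> a) (\<theta> a) = Ident D (Go a)"
    by metis
  have \<eta>: "\<eta> a \<in> Arr D (Fo a) (Go a)" if "a \<in> Obj C" for a
    using nat that by (auto simp: natural_iso_def iso_arr_def)
  have "Comp D (Go a) (Go b) (Fo b) (\<theta> b) (Gm a b f)
      = Comp D (Go a) (Fo a) (Fo b) (Fm a b f) (\<theta> a)"
    if ab: "a \<in> Obj C" "b \<in> Obj C" and f: "f \<in> Arr C a b" for a b f
  proof -
    note obj = F.Fo_in[OF ab(1)] F.Fo_in[OF ab(2)] G.Fo_in[OF ab(1)] G.Fo_in[OF ab(2)]
    note arr = F.Fm_in[OF ab f] G.Fm_in[OF ab f] \<theta>(1)[OF ab(1)] \<theta>(1)[OF ab(2)]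
      \<eta>[OF ab(1)] \<eta>[OF ab(2)]
    have sq: "Comp D (Fo a) (Fo b) (Go b) (\<eta> b) (Fm a b f)
        = Comp D (Fo a) (Go a) (Go b) (Gm a b f) (\<eta> a)"
      using nat ab f by (auto simp: natural_iso_def)
    \<comment> \<open>Inserting \<eta> \<circ> \<theta> = id at the source and applying the
      naturality square gives \<open>Gm a b f\<close> = \<eta> \<circ> \<open>Fm a b f\<close>
      \<circ> \<theta>; composing with \<theta> then cancels \<eta>.\<close>
    have "Gm a b f = Comp D (Go a) (Go a) (Go b) (Gm a b f)
        (Comp D (Go a) (Fo a) (Go a) (\<eta> a) (\<theta> a))"
      using obj arr \<theta> ab by (simp add: F.target.Comp_Ident_right)
    also have "\<dots> = Comp D (Go a) (Fo a) (Go b)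
        (Comp D (Fo a) (Fo b) (Go b) (\<eta> b) (Fm a b f)) (\<theta> a)"
      unfolding sq using obj arr by (intro F.target.Comp_assoc) auto
    also have "\<dots> = Comp D (Go a) (Fo b) (Go b) (\<eta> b)
        (Comp D (Go a) (Fo a) (Fo b) (Fm a b f) (\<theta> a))"
      using obj arr by (intro F.target.Comp_assoc[symmetric]) auto
    finally have *: "Gm a b f = \<dots>" .
    have "Comp D (Go a) (Go b) (Fo b) (\<theta> b) (Gm a b f)
        = Comp D (Go a) (Fo b) (Fo b) (Comp D (Fo b) (Go b) (Fo b) (\<theta> b) (\<eta> b))
            (Comp D (Go a) (Fo a) (Fo b) (Fm a b f) (\<theta> a))"
      unfolding * using obj arr
      by (intro F.target.Comp_assoc F.target.Comp_in[of _ "Fo a"]) auto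
    also have "\<dots> = Comp D (Go a) (Fo a) (Fo b) (Fm a b f) (\<theta> a)"
      using obj arr \<theta> ab by (simp add: F.target.Comp_Ident_left F.target.Comp_in[of _ "Fo a"])
    finally show ?thesis .
  qed
  then have "natural_iso C D Go Gm Fo Fm \<theta>"
    using \<theta> \<eta> unfolding natural_iso_def iso_arr_def by metis
  then show ?thesis by blast
qed

lemma cat_functor_id:
  assumes "category C"
  shows "cat_functor C C (\<lambda>a. a) (\<lambda>a b f. f)"
proof -
  interpret category C by fact
  show ?thesis by unfold_locales auto
qed

lemma cat_functor_comp:
  assumes "cat_functor C D Fo Fm" and "cat_functor D E Go Gm"
  shows "cat_functor C E (\<lambda>a. Go (Fo a)) (\<lambda>a b f. Gm (Fo a) (Fo b) (Fm a b f))"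
proof -
  interpret F: cat_functor C D Fo Fm by fact
  interpret G: cat_functor D E Go Gm by fact
  show ?thesis
    by unfold_locales
      (simp_all add: F.Fo_in F.Fm_in F.Fm_Ident F.Fm_Comp G.Fo_in G.Fm_in G.Fm_Ident G.Fm_Comp)
qed

section \<open>The categories of models and of right-preordered groups\<close>

lemma category_Alg: "category (Alg ar H :: (('f, 'a) algebra, 'a \<Rightarrow> 'a) cat)"
proof
  fix A B D :: "('f, 'a) algebra" and f g
  assume f: "f \<in> Arr (Alg ar H) A B" and g: "g \<in> Arr (Alg ar H) B D"
  then have fm: "f \<in> carrier A \<rightarrow> carrier B" "g \<in> carrier B \<rightarrow> carrier D"
    by (auto simp: Alg_def algebra_hom_def)
  assume "A \<in> Obj (Alg ar H)"
  then have A: "algebra_of ar A" by (simp add: Alg_def)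
  have "compose (carrier A) g f (interp A k xs) = interp D k (map (compose (carrier A) g f) xs)"
    if "length xs = ar k" "set xs \<subseteq> carrier A" for k xs
  proof -
    have "map (compose (carrier A) g f) xs = map g (map f xs)"
      using that by (auto simp: compose_def)
    then have "interp D k (map (compose (carrier A) g f) xs) = interp D k (map g (map f xs))"
      by (rule arg_cong)
    moreover have "set (map f xs) \<subseteq> carrier B"
      using fm that by auto
    \<comment> \<open>\<open>compose\<close> is \<open>undefined\<close> off the carrier, so the
      value of the operation must be known to lie in it.\<close>
    moreover have "interp A k xs \<in> carrier A"
      using A that by (simp add: algebra_of_def)
    moreover have "f (interp A k xs) = interp B k (map f xs)"
      using f that by (simp add: Alg_def algebra_hom_def)
    moreover have "g (interp B k (map f xs)) = interp D k (map g (map f xs))"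
      using g that calculation(2) unfolding Alg_def algebra_hom_def by fastforce
    ultimately show ?thesis
      by (simp add: compose_def)
  qed
  then show "Comp (Alg ar H) A B D g f \<in> Arr (Alg ar H) A D"
    using fm by (auto simp: Alg_def algebra_hom_def compose_def)
next
  fix A :: "('f, 'a) algebra"
  assume "A \<in> Obj (Alg ar H)"
  then show "Ident (Alg ar H) A \<in> Arr (Alg ar H) A A"
    by (auto simp: Alg_def algebra_hom_def algebra_of_def map_idI subset_iff)
next
  fix A B :: "('f, 'a) algebra" and f
  assume "f \<in> Arr (Alg ar H) A B"
  \<comment> \<open>These are equalities of functions on the whole type; they hold because arrows
    are extensional.\<close>
  then show "Comp (Alg ar H) A B B (Ident (Alg ar H) B) f = f"
    "Comp (Alg ar H) A A B f (Ident (Alg ar H) A) = f"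
    by (auto simp: Alg_def algebra_hom_def compose_def PiE_def extensional_def Pi_def fun_eq_iff)
next
  fix A B D E :: "('f, 'a) algebra" and f g h
  assume "f \<in> Arr (Alg ar H) A B"
  then show "Comp (Alg ar H) A D E h (Comp (Alg ar H) A B D g f)
      = Comp (Alg ar H) A B E (Comp (Alg ar H) B D E h g) f"
    by (auto simp: Alg_def algebra_hom_def compose_def PiE_def Pi_def fun_eq_iff)
qed

lemma category_RPOGrp: "category RPOGrp"
proof
  fix G H K :: "'a rpogroup" and f g
  assume "G \<in> Obj RPOGrp" "f \<in> Arr RPOGrp G H" "g \<in> Arr RPOGrp H K"
  moreover from this have "pos_cone G \<subseteq> carrier G" "group G"
    by (auto simp: RPOGrp_def right_preordered_group_def submonoid_def)
  ultimately show "Comp RPOGrp G H K g f \<in> Arr RPOGrp G K"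
    by (auto simp: RPOGrp_def rpo_hom_def hom_def compose_def Pi_def subset_iff
        group.is_monoid monoid.m_closed)
next
  fix G :: "'a rpogroup"
  assume "G \<in> Obj RPOGrp"
  then have "pos_cone G \<subseteq> carrier G" "group G"
    by (auto simp: RPOGrp_def right_preordered_group_def submonoid_def)
  then show "Ident RPOGrp G \<in> Arr RPOGrp G G"
    by (auto simp: RPOGrp_def rpo_hom_def hom_def group.is_monoid monoid.m_closed subset_iff)
next
  fix G H :: "'a rpogroup" and f
  assume "f \<in> Arr RPOGrp G H"
  then show "Comp RPOGrp G H H (Ident RPOGrp H) f = f"
    "Comp RPOGrp G G H f (Ident RPOGrp G) = f"
    by (auto simp: RPOGrp_def rpo_hom_def hom_def compose_def extensional_def Pi_def fun_eq_iff)
next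
  fix G H K L :: "'a rpogroup" and f g h
  assume "f \<in> Arr RPOGrp G H"
  then show "Comp RPOGrp G K L h (Comp RPOGrp G H K g f)
      = Comp RPOGrp G H L (Comp RPOGrp H K L h g) f"
    by (auto simp: RPOGrp_def rpo_hom_def hom_def compose_def Pi_def fun_eq_iff)
qed

section \<open>Bijective morphisms and isomorphisms\<close>

text \<open>The set-theoretic inverse \<open>g\<close> preserves the operations: \<open>h\<close>
  maps \<open>interp A f (map g ys)\<close> to \<open>interp B f ys\<close>, and \<open>g\<close>
  undoes \<open>h\<close>.\<close>

lemma iso_arr_Alg:
  assumes alg: "algebra_of ar A" "algebra_of ar B"
    and h: "h \<in> algebra_hom ar A B" and bij: "bij_betw h (carrier A) (carrier B)"
  shows "iso_arr (Alg ar H) A B h"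
proof -
  \<comment> \<open>The restriction makes the inverse extensional, as an arrow has to be.\<close>
  define g where "g = restrict (inv_into (carrier A) h) (carrier B)"
  have gin: "g y \<in> carrier A" and hg: "h (g y) = y" if "y \<in> carrier B" for y
    using bij that by (auto simp: g_def bij_betw_def inv_into_into f_inv_into_f)
  have gh: "g (h x) = x" if "x \<in> carrier A" for x
    using bij that by (auto simp: g_def bij_betw_def)
  have "g (interp B f ys) = interp A f (map g ys)"
    if ys: "length ys = ar f" "set ys \<subseteq> carrier B" for f ys
  proof -
    have xs: "set (map g ys) \<subseteq> carrier A" "length (map g ys) = ar f"
      using ys gin by auto
    have "map h (map g ys) = ys"
      using ys hg by (simp add: map_idI subset_iff)
    then have "h (interp A f (map g ys)) = interp B f ys"
      using h xs by (simp add: algebra_hom_def)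
    moreover have "interp A f (map g ys) \<in> carrier A"
      using alg(1) xs unfolding algebra_of_def by blast
    ultimately show ?thesis
      using gh by metis
  qed
  moreover have "g \<in> extensional (carrier B)" by (simp add: g_def)
  ultimately have "g \<in> algebra_hom ar B A"
    using gin by (auto simp: algebra_hom_def PiE_def)
  then show ?thesis
    using h gh hg
    by (auto simp: iso_arr_def Alg_def compose_def fun_eq_iff intro!: bexI[of _ g])
qed

text \<open>Bijectivity alone does not make a morphism invertible: the identity of the integers from
  the cone {0} to the natural numbers is a counterexample. With \<open>cone\<close> the inverse
  preserves positivity.\<close>

lemma iso_arr_RPOGrp:
  assumes G: "right_preordered_group G" and H: "right_preordered_group H"
    and h: "h \<in> rpo_hom G H" and bij: "bij_betw h (carrier G) (carrier H)"
    and cone: "pos_cone H \<subseteq> h ` pos_cone G"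
  shows "iso_arr RPOGrp G H h"
proof -
  interpret G: right_preordered_group G by (rule G)
  interpret H: right_preordered_group H by (rule H)
  define g where "g = restrict (inv_into (carrier G) h) (carrier H)"
  have gin: "g y \<in> carrier G" and hg: "h (g y) = y" if "y \<in> carrier H" for y
    using bij that by (auto simp: g_def bij_betw_def inv_into_into f_inv_into_f)
  have gh: "g (h x) = x" if "x \<in> carrier G" for x
    using bij that by (auto simp: g_def bij_betw_def)
  have "g (x \<otimes>\<^bsub>H\<^esub> y) = g x \<otimes>\<^bsub>G\<^esub> g y" if xy: "x \<in> carrier H" "y \<in> carrier H" for x y
  proof -
    have "h (g x \<otimes>\<^bsub>G\<^esub> g y) = x \<otimes>\<^bsub>H\<^esub> y"
      using h xy gin hg by (simp add: rpo_hom_def hom_def)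
    then show ?thesis
      using gh[of "g x \<otimes>\<^bsub>G\<^esub> g y"] gin xy by simp
  qed
  moreover have "g ` pos_cone H \<subseteq> pos_cone G"
    using cone gh G.subset by force
  moreover have "g \<in> extensional (carrier H)" by (simp add: g_def)
  ultimately have "g \<in> rpo_hom H G"
    using gin by (auto simp: rpo_hom_def hom_def)
  then show ?thesis
    using h gh hg
    by (auto simp: iso_arr_def RPOGrp_def compose_def fun_eq_iff intro!: bexI[of _ g])
qed


section \<open>Models of the theory of right-preordered groups\<close>

abbreviation m_zero ("o\<index>") where "o\<^bsub>A\<^esub> \<equiv> interp A Zero []"
abbreviation m_iota ("\<iota>\<index> _" [80] 80) where "\<iota>\<^bsub>A\<^esub> x \<equiv> interp A Iota [x]"
abbreviation m_pi0 ("\<pi>0\<index> _" [80] 80) where "\<pi>0\<^bsub>A\<^esub> x \<equiv> interp A Pi0 [x]"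
abbreviation m_pi1 ("\<pi>1\<index> _" [80] 80) where "\<pi>1\<^bsub>A\<^esub> x \<equiv> interp A Pi1 [x]"
abbreviation m_neg ("\<ominus>\<ominus>\<index> _" [80] 80) where "\<ominus>\<ominus>\<^bsub>A\<^esub> x \<equiv> interp A Neg [x]"
abbreviation m_plus (infixl "\<boxplus>\<index>" 65) where "x \<boxplus>\<^bsub>A\<^esub> y \<equiv> interp A Plus [x, y]"


lemma algebra_of_rpo_iff:
  "algebra_of rpo_arity A \<longleftrightarrow> o\<^bsub>A\<^esub> \<in> carrier A \<and>
     (\<forall>x \<in> carrier A. \<iota>\<^bsub>A\<^esub> x \<in> carrier A \<and> \<pi>0\<^bsub>A\<^esub> x \<in> carrier A \<and> \<pi>1\<^bsub>A\<^esub> x \<in> carrier A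
        \<and> \<ominus>\<ominus>\<^bsub>A\<^esub> x \<in> carrier A) \<and>
     (\<forall>x \<in> carrier A. \<forall>y \<in> carrier A. x \<boxplus>\<^bsub>A\<^esub> y \<in> carrier A)" (is "?L \<longleftrightarrow> ?R")
proof
  assume L: ?L
  then have 1: "interp A f [x] \<in> carrier A" if "rpo_arity f = 1" "x \<in> carrier A" for f x
    using that by (simp add: algebra_of_def)
  have 2: "interp A f [x, y] \<in> carrier A"
    if "rpo_arity f = 2" "x \<in> carrier A" "y \<in> carrier A" for f x y
    using L that by (simp add: algebra_of_def)
  have "interp A Zero [] \<in> carrier A"
    using L by (simp add: algebra_of_def)
  then show ?R
    using 1 2 by simp
next
  assume ?R
  then show ?L
    unfolding algebra_of_def
    \<comment> \<open>\<open>length_Suc_conv\<close> writes an argument list of length 1 or 2 as an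
      explicit list.\<close>
    by (intro allI, case_tac f)
      (auto simp: length_Suc_conv numeral_2_eq_2)
qed

lemma algebra_hom_rpo_iff:
  "h \<in> algebra_hom rpo_arity A B \<longleftrightarrow> h \<in> carrier A \<rightarrow>\<^sub>E carrier B \<and> h o\<^bsub>A\<^esub> = o\<^bsub>B\<^esub> \<and>
     (\<forall>x \<in> carrier A. h (\<iota>\<^bsub>A\<^esub> x) = \<iota>\<^bsub>B\<^esub> (h x) \<and> h (\<pi>0\<^bsub>A\<^esub> x) = \<pi>0\<^bsub>B\<^esub> (h x)
        \<and> h (\<pi>1\<^bsub>A\<^esub> x) = \<pi>1\<^bsub>B\<^esub> (h x) \<and> h (\<ominus>\<ominus>\<^bsub>A\<^esub> x) = \<ominus>\<ominus>\<^bsub>B\<^esub> (h x)) \<and>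
     (\<forall>x \<in> carrier A. \<forall>y \<in> carrier A. h (x \<boxplus>\<^bsub>A\<^esub> y) = h x \<boxplus>\<^bsub>B\<^esub> h y)" (is "?L \<longleftrightarrow> ?R")
proof
  assume L: ?L
  have 1: "h (interp A f [x]) = interp B f [h x]" if "rpo_arity f = 1" "x \<in> carrier A" for f x
    using L that by (simp add: algebra_hom_def)
  have 2: "h (interp A f [x, y]) = interp B f [h x, h y]"
    if "rpo_arity f = 2" "x \<in> carrier A" "y \<in> carrier A" for f x y
    using L that by (simp add: algebra_hom_def)
  have "h (interp A Zero []) = interp B Zero []" "h \<in> carrier A \<rightarrow>\<^sub>E carrier B"
    using L by (simp_all add: algebra_hom_def)
  then show ?R
    using 1 2 by simp
next
  assume R: ?R
  have "h (interp A f xs) = interp B f (map h xs)"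
    if "length xs = rpo_arity f" "set xs \<subseteq> carrier A" for f xs
    using R that by (cases f) (auto simp: length_Suc_conv numeral_2_eq_2)
  then show ?L
    using R by (simp add: algebra_hom_def)
qed

text \<open>The axioms with their terms already evaluated and their chains of equations cut into
  single ones, so that the simplifier can use them. That these are exactly the models is
  \<open>rpo_model_iff\<close>.\<close>

locale rpo_model =
  fixes A :: "(rpo_op, 'a) algebra" (structure)
  assumes zero_closed [simp]: "o \<in> carrier A"
    and iota_closed [simp]: "a \<in> carrier A \<Longrightarrow> \<iota> a \<in> carrier A"
    and pi0_closed [simp]: "a \<in> carrier A \<Longrightarrow> \<pi>0 a \<in> carrier A"
    and pi1_closed [simp]: "a \<in> carrier A \<Longrightarrow> \<pi>1 a \<in> carrier A"
    and neg_closed [simp]: "a \<in> carrier A \<Longrightarrow> \<ominus>\<ominus> a \<in> carrier A"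
    and plus_closed [simp]: "\<lbrakk>a \<in> carrier A; b \<in> carrier A\<rbrakk> \<Longrightarrow> a \<boxplus> b \<in> carrier A"
    and plus_assoc:
      "\<lbrakk>a \<in> carrier A; b \<in> carrier A; c \<in> carrier A\<rbrakk> \<Longrightarrow> (a \<boxplus> b) \<boxplus> c = a \<boxplus> (b \<boxplus> c)"
    and zero_plus [simp]: "a \<in> carrier A \<Longrightarrow> o \<boxplus> a = a"
    and plus_zero [simp]: "a \<in> carrier A \<Longrightarrow> a \<boxplus> o = a"
    and iota_plus: "\<lbrakk>a \<in> carrier A; b \<in> carrier A\<rbrakk> \<Longrightarrow> \<iota> a \<boxplus> \<iota> b = \<iota> (a \<boxplus> b)"
    and pi0_plus: "\<lbrakk>a \<in> carrier A; b \<in> carrier A\<rbrakk> \<Longrightarrow> \<pi>0 a \<boxplus> \<pi>0 b = \<pi>0 (a \<boxplus> b)"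
    and pi1_plus: "\<lbrakk>a \<in> carrier A; b \<in> carrier A\<rbrakk> \<Longrightarrow> \<pi>1 a \<boxplus> \<pi>1 b = \<pi>1 (a \<boxplus> b)"
    and iota_zero [simp]: "\<iota> o = o"
    and pi0_zero [simp]: "\<pi>0 o = o"
    and pi1_zero [simp]: "\<pi>1 o = o"
    and split: "a \<in> carrier A \<Longrightarrow> a = \<pi>0 a \<boxplus> \<pi>1 a"
    and split_commute: "a \<in> carrier A \<Longrightarrow> \<pi>0 a \<boxplus> \<pi>1 a = \<pi>1 a \<boxplus> \<pi>0 a"
    and neg_pi1 [simp]: "a \<in> carrier A \<Longrightarrow> \<ominus>\<ominus> (\<pi>1 a) = o"
    and pi1_iota [simp]: "a \<in> carrier A \<Longrightarrow> \<pi>1 (\<iota> a) = o"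
    and pi0_pi1 [simp]: "a \<in> carrier A \<Longrightarrow> \<pi>0 (\<pi>1 a) = o"
    and pi1_pi0 [simp]: "a \<in> carrier A \<Longrightarrow> \<pi>1 (\<pi>0 a) = o"
    and iota_pi1_eq: "a \<in> carrier A \<Longrightarrow> \<iota> (\<pi>1 a) = \<pi>0 (\<iota> a)"
    and plus_neg_commute: "a \<in> carrier A \<Longrightarrow> a \<boxplus> \<ominus>\<ominus> a = \<ominus>\<ominus> a \<boxplus> a"
    and neg_plus: "a \<in> carrier A \<Longrightarrow> \<ominus>\<ominus> a \<boxplus> a = \<pi>1 a"
    and iota_inj: "\<lbrakk>a \<in> carrier A; b \<in> carrier A; \<iota> a = \<iota> b\<rbrakk> \<Longrightarrow> \<pi>1 a = \<pi>1 b"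

text \<open>Each axiom mentions at most the variables 0, 1 and 2. All remaining variables also get
  the value \<open>c\<close>, which keeps the range of the valuation in the carrier.\<close>

lemma satisfiesD:
  assumes "satisfies A q" and "a \<in> carrier A" "b \<in> carrier A" "c \<in> carrier A"
    and "v = (\<lambda>n. if n = 0 then a else if n = 1 then b else c)"
    and "\<forall>e \<in> set (hypotheses q). satisfies_eq A v e"
  shows "satisfies_eq A v (consequent q)"
proof -
  have "range v \<subseteq> carrier A"
    using assms(2-5) by auto
  with assms(1,6) show ?thesis
    by (simp add: satisfies_def)
qed

lemma rpo_model_iff: "A \<in> Obj (Alg rpo_arity rpo_axioms) \<longleftrightarrow> rpo_model A" (is "?L \<longleftrightarrow> ?R")
proof
  assume ?L
  then have alg: "algebra_of rpo_arity A" and sat: "\<And>q. q \<in> rpo_axioms \<Longrightarrow> satisfies A q"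
    by (auto simp: Alg_def)
  note defs = rpo_axioms_def axioms_M_def axioms_P1_def axioms_P2_def axioms_P3_def
    axioms_G_def axioms_Inj_def
  \<comment> \<open>This covers the axioms without hypotheses; (Inj) is obtained from
    \<open>satisfiesD\<close> directly.\<close>
  have eq: "eval_trm A (\<lambda>n. if n = 0 then a else if n = 1 then b else c) s
      = eval_trm A (\<lambda>n. if n = 0 then a else if n = 1 then b else c) t"
    if "(s [=] t) \<in> rpo_axioms" "a \<in> carrier A" "b \<in> carrier A" "c \<in> carrier A" for s t a b c
    using satisfiesD[OF sat[OF that(1)] that(2-4) refl] by (simp add: satisfies_eq_def)
  show ?R
  proof
    fix a b c assume c: "a \<in> carrier A" "b \<in> carrier A" "c \<in> carrier A"
    show "a \<boxplus>\<^bsub>A\<^esub> b \<boxplus>\<^bsub>A\<^esub> c = a \<boxplus>\<^bsub>A\<^esub> (b \<boxplus>\<^bsub>A\<^esub> c)"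
      using eq[of "(Var 0 [+] Var 1) [+] Var 2" "Var 0 [+] (Var 1 [+] Var 2)" a b c] c
      by (simp add: defs)
  next
    fix a b assume c: "a \<in> carrier A" "b \<in> carrier A"
    show "\<iota>\<^bsub>A\<^esub> a \<boxplus>\<^bsub>A\<^esub> \<iota>\<^bsub>A\<^esub> b = \<iota>\<^bsub>A\<^esub> (a \<boxplus>\<^bsub>A\<^esub> b)"
      using eq[of "iota_t (Var 0) [+] iota_t (Var 1)" "iota_t (Var 0 [+] Var 1)" a b b] c
      by (simp add: defs)
    show "\<pi>0\<^bsub>A\<^esub> a \<boxplus>\<^bsub>A\<^esub> \<pi>0\<^bsub>A\<^esub> b = \<pi>0\<^bsub>A\<^esub> (a \<boxplus>\<^bsub>A\<^esub> b)"
      using eq[of "pi0_t (Var 0) [+] pi0_t (Var 1)" "pi0_t (Var 0 [+] Var 1)" a b b] c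
      by (simp add: defs)
    show "\<pi>1\<^bsub>A\<^esub> a \<boxplus>\<^bsub>A\<^esub> \<pi>1\<^bsub>A\<^esub> b = \<pi>1\<^bsub>A\<^esub> (a \<boxplus>\<^bsub>A\<^esub> b)"
      using eq[of "pi1_t (Var 0) [+] pi1_t (Var 1)" "pi1_t (Var 0 [+] Var 1)" a b b] c
      by (simp add: defs)
    show "a \<boxplus>\<^bsub>A\<^esub> b \<in> carrier A"
      using alg c by (simp add: algebra_of_rpo_iff)
    assume "\<iota>\<^bsub>A\<^esub> a = \<iota>\<^bsub>A\<^esub> b"
    then show "\<pi>1\<^bsub>A\<^esub> a = \<pi>1\<^bsub>A\<^esub> b"
      using satisfiesD[OF sat c c(2) refl,
          of "Quasi_Eq [(iota_t (Var 0), iota_t (Var 1))] (pi1_t (Var 0), pi1_t (Var 1))"]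
      by (simp add: defs satisfies_eq_def)
  next
    fix a assume a: "a \<in> carrier A"
    show "\<iota>\<^bsub>A\<^esub> a \<in> carrier A" "\<pi>0\<^bsub>A\<^esub> a \<in> carrier A" "\<pi>1\<^bsub>A\<^esub> a \<in> carrier A" "\<ominus>\<ominus>\<^bsub>A\<^esub> a \<in> carrier A"
      using alg a by (simp_all add: algebra_of_rpo_iff)
    note e = eq[OF _ a a a]
    show "o\<^bsub>A\<^esub> \<boxplus>\<^bsub>A\<^esub> a = a"
      using e[of "zero_t [+] Var 0" "Var 0"] by (simp add: defs)
    show "a \<boxplus>\<^bsub>A\<^esub> o\<^bsub>A\<^esub> = a"
      using e[of "Var 0 [+] zero_t" "Var 0"] by (simp add: defs)
    show "a = \<pi>0\<^bsub>A\<^esub> a \<boxplus>\<^bsub>A\<^esub> \<pi>1\<^bsub>A\<^esub> a"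
      using e[of "Var 0" "pi0_t (Var 0) [+] pi1_t (Var 0)"] by (simp add: defs)
    show "\<pi>0\<^bsub>A\<^esub> a \<boxplus>\<^bsub>A\<^esub> \<pi>1\<^bsub>A\<^esub> a = \<pi>1\<^bsub>A\<^esub> a \<boxplus>\<^bsub>A\<^esub> \<pi>0\<^bsub>A\<^esub> a"
      using e[of "pi0_t (Var 0) [+] pi1_t (Var 0)" "pi1_t (Var 0) [+] pi0_t (Var 0)"]
      by (simp add: defs)
    show "\<ominus>\<ominus>\<^bsub>A\<^esub> \<pi>1\<^bsub>A\<^esub> a = o\<^bsub>A\<^esub>"
      using e[of "neg_t (pi1_t (Var 0))" zero_t] by (simp add: defs)
    show "\<pi>1\<^bsub>A\<^esub> \<iota>\<^bsub>A\<^esub> a = o\<^bsub>A\<^esub>"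
      using e[of "pi1_t (iota_t (Var 0))" zero_t] by (simp add: defs)
    show "\<pi>0\<^bsub>A\<^esub> \<pi>1\<^bsub>A\<^esub> a = o\<^bsub>A\<^esub>"
      using e[of "pi0_t (pi1_t (Var 0))" zero_t] by (simp add: defs)
    show "\<pi>1\<^bsub>A\<^esub> \<pi>0\<^bsub>A\<^esub> a = o\<^bsub>A\<^esub>"
      using e[of "pi1_t (pi0_t (Var 0))" zero_t] by (simp add: defs)
    show "\<iota>\<^bsub>A\<^esub> \<pi>1\<^bsub>A\<^esub> a = \<pi>0\<^bsub>A\<^esub> \<iota>\<^bsub>A\<^esub> a"
      using e[of "iota_t (pi1_t (Var 0))" "pi0_t (iota_t (Var 0))"] by (simp add: defs)
    show "a \<boxplus>\<^bsub>A\<^esub> \<ominus>\<ominus>\<^bsub>A\<^esub> a = \<ominus>\<ominus>\<^bsub>A\<^esub> a \<boxplus>\<^bsub>A\<^esub> a"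
      using e[of "Var 0 [+] neg_t (Var 0)" "neg_t (Var 0) [+] Var 0"] by (simp add: defs)
    show "\<ominus>\<ominus>\<^bsub>A\<^esub> a \<boxplus>\<^bsub>A\<^esub> a = \<pi>1\<^bsub>A\<^esub> a"
      using e[of "neg_t (Var 0) [+] Var 0" "pi1_t (Var 0)"] by (simp add: defs)
  next
    show z: "o\<^bsub>A\<^esub> \<in> carrier A"
      using alg by (simp add: algebra_of_rpo_iff)
    \<comment> \<open>The remaining axioms are closed, but a valuation still needs values in the
      carrier; \<open>o\<close> serves.\<close>
    note e = eq[OF _ z z z]
    show "\<iota>\<^bsub>A\<^esub> o\<^bsub>A\<^esub> = o\<^bsub>A\<^esub>"
      using e[of "iota_t zero_t" zero_t] by (simp add: defs)
    show "\<pi>0\<^bsub>A\<^esub> o\<^bsub>A\<^esub> = o\<^bsub>A\<^esub>"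
      using e[of "pi0_t zero_t" zero_t] by (simp add: defs)
    show "\<pi>1\<^bsub>A\<^esub> o\<^bsub>A\<^esub> = o\<^bsub>A\<^esub>"
      using e[of "pi1_t zero_t" zero_t] by (simp add: defs)
  qed
next
  assume ?R
  then interpret rpo_model A .
  have "satisfies_eq A v (consequent q)"
    if q: "q \<in> rpo_axioms" and v: "range v \<subseteq> carrier A"
      and hyp: "\<forall>e \<in> set (hypotheses q). satisfies_eq A v e" for q v
  proof -
    have [simp]: "v n \<in> carrier A" for n using v by auto
    show ?thesis
      using q hyp
      unfolding rpo_axioms_def axioms_M_def axioms_P1_def axioms_P2_def axioms_P3_def
        axioms_G_def axioms_Inj_def
      by (auto simp: satisfies_eq_def plus_assoc iota_plus pi0_plus pi1_plus split[symmetric]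
          split_commute[symmetric] iota_pi1_eq plus_neg_commute neg_plus intro!: iota_inj)
  qed
  then show ?L
    by (simp add: Alg_def satisfies_def algebra_of_rpo_iff)
qed

section \<open>Consequences of the axioms\<close>

context rpo_model
begin

lemma pi0_pi0 [simp]: "a \<in> carrier A \<Longrightarrow> \<pi>0 (\<pi>0 a) = \<pi>0 a"
  using split[of "\<pi>0 a"] by simp

lemma pi0_eq: "\<lbrakk>a \<in> carrier A; \<pi>1 a = o\<rbrakk> \<Longrightarrow> \<pi>0 a = a"
  using split[of a] by simp

text \<open>By (P3) the left side is \<open>\<pi>\<^sub>0\<close> of \<iota>(a), which equals
  \<iota>(a) because \<open>\<pi>\<^sub>1\<close> kills it. So \<iota> sees only the component in
  \<open>M\<^sub>1\<close>.\<close>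

lemma iota_pi1 [simp]: "a \<in> carrier A \<Longrightarrow> \<iota> (\<pi>1 a) = \<iota> a"
  by (simp add: iota_pi1_eq pi0_eq)

lemma iota_eq_zero: "\<lbrakk>a \<in> carrier A; \<pi>1 a = o\<rbrakk> \<Longrightarrow> \<iota> a = o"
  using iota_pi1[of a] by simp

lemma zero_in_iota_image [simp]: "o \<in> (\<lambda>x. \<iota> x) ` carrier A"
  by (rule image_eqI[of _ _ "o"]) simp_all

lemma plus_neg: "a \<in> carrier A \<Longrightarrow> a \<boxplus> \<ominus>\<ominus> a = \<pi>1 a"
  by (simp add: plus_neg_commute neg_plus)

text \<open>Applying \<open>\<pi>\<^sub>1\<close> to a + (-a) = \<open>\<pi>\<^sub>1\<close> a = 0
  leaves the component of -a. This closes \<open>M\<^sub>0\<close> under negation.\<close>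

lemma pi1_neg:
  assumes "a \<in> carrier A" "\<pi>1 a = o"
  shows "\<pi>1 (\<ominus>\<ominus> a) = o"
  using pi1_plus[of a "\<ominus>\<ominus> a"] assms by (simp add: plus_neg)

end

section \<open>The right-preordered group of a model\<close>

text \<open>The cone is the image of the whole carrier, which by \<open>iota_pi1\<close> is the same
  as the image of \<open>M\<^sub>1\<close>.\<close>

definition group_part :: "(rpo_op, 'a) algebra \<Rightarrow> 'a rpogroup" where
  "group_part A = \<lparr>carrier = {x \<in> carrier A. \<pi>1\<^bsub>A\<^esub> x = o\<^bsub>A\<^esub>}, mult = (\<lambda>x y. x \<boxplus>\<^bsub>A\<^esub> y),
     one = o\<^bsub>A\<^esub>, pos_cone = (\<lambda>x. \<iota>\<^bsub>A\<^esub> x) ` carrier A\<rparr>"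

lemma group_part_simps [simp]:
  "x \<in> carrier (group_part A) \<longleftrightarrow> x \<in> carrier A \<and> \<pi>1\<^bsub>A\<^esub> x = o\<^bsub>A\<^esub>"
  "x \<otimes>\<^bsub>group_part A\<^esub> y = x \<boxplus>\<^bsub>A\<^esub> y"
  "\<one>\<^bsub>group_part A\<^esub> = o\<^bsub>A\<^esub>"
  "pos_cone (group_part A) = (\<lambda>x. \<iota>\<^bsub>A\<^esub> x) ` carrier A"
  by (simp_all add: group_part_def)

context rpo_model
begin

text \<open>On \<open>M\<^sub>0\<close> axiom (G) reads -x + x = 0, so negation gives left inverses.
  The cone lies in \<open>M\<^sub>0\<close> by \<open>pi1_iota\<close> and is a submonoid because
  \<iota> is additive.\<close>

lemma right_preordered_group_part: "right_preordered_group (group_part A)"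
proof -
  interpret G: group "group_part A"
  proof (rule groupI)
    fix x y assume "x \<in> carrier (group_part A)" "y \<in> carrier (group_part A)"
    then show "x \<otimes>\<^bsub>group_part A\<^esub> y \<in> carrier (group_part A)"
      by (simp flip: pi1_plus)
  next
    fix x assume "x \<in> carrier (group_part A)"
    then show "\<exists>y \<in> carrier (group_part A). y \<otimes>\<^bsub>group_part A\<^esub> x = \<one>\<^bsub>group_part A\<^esub>"
      by (intro bexI[of _ "\<ominus>\<ominus> x"]) (auto simp: neg_plus pi1_neg)
  qed (auto simp: plus_assoc)
  show ?thesis
  proof
    show "pos_cone (group_part A) \<subseteq> carrier (group_part A)" by auto
    show "\<one>\<^bsub>group_part A\<^esub> \<in> pos_cone (group_part A)"
      by simp
    fix x y assume "x \<in> pos_cone (group_part A)" "y \<in> pos_cone (group_part A)"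
    then show "x \<otimes>\<^bsub>group_part A\<^esub> y \<in> pos_cone (group_part A)"
      by (auto simp: iota_plus)
  qed
qed

text \<open>Since a + (-a) = \<open>\<pi>\<^sub>1\<close> a, additivity gives \<iota>(a) +
  \<iota>(-a) = \<iota>(a). Both summands lie in the group \<open>M\<^sub>0\<close>, where
  \<iota>(a) cancels.\<close>

lemma iota_neg:
  assumes a: "a \<in> carrier A"
  shows "\<iota> (\<ominus>\<ominus> a) = o"
proof -
  interpret G: right_preordered_group "group_part A" by (rule right_preordered_group_part)
  have "\<iota> a \<boxplus> \<iota> (\<ominus>\<ominus> a) = \<iota> a"
    using a by (simp add: iota_plus plus_neg)
  then show ?thesis
    using G.l_cancel_one[of "\<iota> a" "\<iota> (\<ominus>\<ominus> a)"] a by simp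
qed

text \<open>Applying \<open>\<pi>\<^sub>0\<close> to -a + a = \<open>\<pi>\<^sub>1\<close> a gives 0
  on the right, so the element is a left inverse.\<close>

lemma pi0_neg:
  assumes a: "a \<in> carrier A"
  shows "\<pi>0 (\<ominus>\<ominus> a) = inv\<^bsub>group_part A\<^esub> (\<pi>0 a)"
proof -
  interpret G: right_preordered_group "group_part A" by (rule right_preordered_group_part)
  have "\<pi>0 (\<ominus>\<ominus> a) \<boxplus> \<pi>0 a = o"
    using a by (simp add: pi0_plus neg_plus)
  then show ?thesis
    using G.inv_equality[of "\<pi>0 (\<ominus>\<ominus> a)" "\<pi>0 a"] a by simp
qed

end


section \<open>The model of a right-preordered group\<close>

text \<open>Objects of both categories have their carriers in the one type \<open>'u\<close>, so an
  element of G \<times> P has to be named by an element of \<open>'u\<close>.\<close>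

locale pairing =
  fixes pair :: "'u \<times> 'u \<Rightarrow> 'u"
  assumes inj_pair: "inj pair"
begin

definition unpair :: "'u \<Rightarrow> 'u \<times> 'u" where "unpair = inv_into UNIV pair"

lemma unpair_pair [simp]: "unpair (pair x) = x"
  by (simp add: unpair_def inj_pair)

lemma pair_eq_iff [simp]: "pair x = pair y \<longleftrightarrow> x = y"
  using inj_pair by (auto dest: injD)

text \<open>Two arguments are decoded for every operation. On a shorter list \<open>xs ! 0\<close>
  or \<open>xs ! 1\<close> is an unspecified value, which the branch of that operation does not
  read.\<close>

definition cone_model :: "'u rpogroup \<Rightarrow> (rpo_op, 'u) algebra" where
  "cone_model G =
     \<lparr>carrier = pair ` (carrier G \<times> pos_cone G),
      interp = (\<lambda>f xs. let (g, p) = unpair (xs ! 0); (h, q) = unpair (xs ! 1) in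
        pair (case f of
            Zero \<Rightarrow> (\<one>\<^bsub>G\<^esub>, \<one>\<^bsub>G\<^esub>)
          | Iota \<Rightarrow> (p, \<one>\<^bsub>G\<^esub>)
          | Pi0 \<Rightarrow> (g, \<one>\<^bsub>G\<^esub>)
          | Pi1 \<Rightarrow> (\<one>\<^bsub>G\<^esub>, p)
          | Neg \<Rightarrow> (inv\<^bsub>G\<^esub> g, \<one>\<^bsub>G\<^esub>)
          | Plus \<Rightarrow> (g \<otimes>\<^bsub>G\<^esub> h, p \<otimes>\<^bsub>G\<^esub> q)))\<rparr>"

lemma carrier_cone_model: "carrier (cone_model G) = pair ` (carrier G \<times> pos_cone G)"
  by (simp add: cone_model_def)

lemma pair_in_cone_model [simp]:
  "pair (g, p) \<in> carrier (cone_model G) \<longleftrightarrow> g \<in> carrier G \<and> p \<in> pos_cone G"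
  by (auto simp: carrier_cone_model)

lemma cone_model_cases:
  assumes "x \<in> carrier (cone_model G)"
  obtains g p where "x = pair (g, p)" "g \<in> carrier G" "p \<in> pos_cone G"
  using assms by (auto simp: carrier_cone_model)

lemma cone_model_interp [simp]:
  "o\<^bsub>cone_model G\<^esub> = pair (\<one>\<^bsub>G\<^esub>, \<one>\<^bsub>G\<^esub>)"
  "\<iota>\<^bsub>cone_model G\<^esub> (pair (g, p)) = pair (p, \<one>\<^bsub>G\<^esub>)"
  "\<pi>0\<^bsub>cone_model G\<^esub> (pair (g, p)) = pair (g, \<one>\<^bsub>G\<^esub>)"
  "\<pi>1\<^bsub>cone_model G\<^esub> (pair (g, p)) = pair (\<one>\<^bsub>G\<^esub>, p)"
  "\<ominus>\<ominus>\<^bsub>cone_model G\<^esub> (pair (g, p)) = pair (inv\<^bsub>G\<^esub> g, \<one>\<^bsub>G\<^esub>)"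
  "pair (g, p) \<boxplus>\<^bsub>cone_model G\<^esub> pair (h, q) = pair (g \<otimes>\<^bsub>G\<^esub> h, p \<otimes>\<^bsub>G\<^esub> q)"
  by (simp_all add: cone_model_def split: prod.split)

text \<open>Everything is checked coordinatewise. (G) is (g, p) + (-g, 0) = (0, p), and (Inj) holds
  because \<iota>(g, p) = (p, 0) determines p. The inclusion of the cone in the group puts (p, 0) in
  the carrier.\<close>

lemma rpo_model_cone_model:
  assumes "right_preordered_group G"
  shows "rpo_model (cone_model G)"
proof -
  interpret right_preordered_group G by fact
  have [simp]: "p \<in> carrier G" if "p \<in> pos_cone G" for p
    using that subset by blast
  show ?thesis
    by unfold_locales (auto elim!: cone_model_cases simp: m_assoc)
qed

definition cone_map :: "'u rpogroup \<Rightarrow> ('u \<Rightarrow> 'u) \<Rightarrow> 'u \<Rightarrow> 'u" where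
  "cone_map G f = (\<lambda>x \<in> carrier (cone_model G). pair (map_prod f f (unpair x)))"

lemma cone_map_pair [simp]:
  "\<lbrakk>g \<in> carrier G; p \<in> pos_cone G\<rbrakk> \<Longrightarrow> cone_map G f (pair (g, p)) = pair (f g, f p)"
  by (simp add: cone_map_def)

lemma cone_map_hom:
  assumes G: "right_preordered_group G" and H: "right_preordered_group H"
    and f: "f \<in> rpo_hom G H"
  shows "cone_map G f \<in> algebra_hom rpo_arity (cone_model G) (cone_model H)"
proof -
  interpret G: right_preordered_group G by (rule G)
  interpret H: right_preordered_group H by (rule H)
  \<comment> \<open>Supplies preservation of the unit and of inverses, needed for
    \<open>Zero\<close> and \<open>Neg\<close>.\<close>
  interpret f: group_hom G H f
    using f by unfold_locales (simp add: rpo_hom_def)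
  have [simp]: "p \<in> carrier G" if "p \<in> pos_cone G" for p
    using that G.subset by blast
  have [simp]: "f p \<in> pos_cone H" if "p \<in> pos_cone G" for p
    using that f by (auto simp: rpo_hom_def)
  have "cone_map G f \<in> extensional (carrier (cone_model G))"
    by (simp add: cone_map_def)
  then show ?thesis
    unfolding algebra_hom_rpo_iff PiE_def
    by (auto elim!: cone_model_cases)
qed

end

section \<open>The two functors\<close>

text \<open>Commuting with \<open>\<pi>\<^sub>1\<close> and 0, \<open>h\<close> maps
  \<open>M\<^sub>0\<close> to \<open>M\<^sub>0\<close>; commuting with \<iota>, it maps cone to
  cone.\<close>

lemma group_part_hom:
  assumes A: "rpo_model A" and B: "rpo_model B" and h: "h \<in> algebra_hom rpo_arity A B"
  shows "restrict h (carrier (group_part A)) \<in> rpo_hom (group_part A) (group_part B)"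
proof -
  interpret A: rpo_model A by (rule A)
  interpret B: rpo_model B by (rule B)
  note h' = h[unfolded algebra_hom_rpo_iff]
  have in_B: "h x \<in> carrier B" if "x \<in> carrier A" for x
    using h' that by auto
  have pi1: "\<pi>1\<^bsub>B\<^esub> (h x) = o\<^bsub>B\<^esub>" if "x \<in> carrier A" "\<pi>1\<^bsub>A\<^esub> x = o\<^bsub>A\<^esub>" for x
    using h' that by metis
  show ?thesis
    using h' in_B pi1 by (auto simp: rpo_hom_def hom_def simp flip: A.pi1_plus)
qed

lemma cat_functor_group_part:
  "cat_functor (Alg rpo_arity rpo_axioms) RPOGrp group_part
     (\<lambda>A B h. restrict h (carrier (group_part A)))"
proof -
  interpret C: category "Alg rpo_arity rpo_axioms" by (rule category_Alg)
  interpret D: category RPOGrp by (rule category_RPOGrp)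
  show ?thesis
  proof
    fix A :: "(rpo_op, 'a) algebra" assume "A \<in> Obj (Alg rpo_arity rpo_axioms)"
    then show "group_part A \<in> Obj RPOGrp"
      by (simp add: rpo_model_iff RPOGrp_def rpo_model.right_preordered_group_part)
    show "restrict (Ident (Alg rpo_arity rpo_axioms) A) (carrier (group_part A))
        = Ident RPOGrp (group_part A)"
      by (auto simp: Alg_def RPOGrp_def fun_eq_iff)
  next
    fix A B :: "(rpo_op, 'a) algebra" and h
    assume "A \<in> Obj (Alg rpo_arity rpo_axioms)" "B \<in> Obj (Alg rpo_arity rpo_axioms)"
      "h \<in> Arr (Alg rpo_arity rpo_axioms) A B"
    then have hom: "restrict h (carrier (group_part A)) \<in> rpo_hom (group_part A) (group_part B)"
      by (intro group_part_hom) (simp_all add: rpo_model_iff, simp add: Alg_def)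
    then show "restrict h (carrier (group_part A)) \<in> Arr RPOGrp (group_part A) (group_part B)"
      by (simp add: RPOGrp_def)
    fix D :: "(rpo_op, 'a) algebra" and g
    \<comment> \<open>Ensures that the restriction of \<open>g\<close> is only applied inside its
      domain.\<close>
    have "h x \<in> carrier (group_part B)" if "x \<in> carrier (group_part A)" for x
      using hom that by (auto simp: rpo_hom_def hom_def Pi_def)
    then show "restrict (Comp (Alg rpo_arity rpo_axioms) A B D g h) (carrier (group_part A))
        = Comp RPOGrp (group_part A) (group_part B) (group_part D)
            (restrict g (carrier (group_part B))) (restrict h (carrier (group_part A)))"
      by (auto simp: Alg_def RPOGrp_def compose_def fun_eq_iff)
  qed
qed

context pairing
begin

lemma cat_functor_cone_model:
  "cat_functor RPOGrp (Alg rpo_arity rpo_axioms) cone_model (\<lambda>G H f. cone_map G f)"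
proof -
  interpret C: category "Alg rpo_arity rpo_axioms" by (rule category_Alg)
  interpret D: category RPOGrp by (rule category_RPOGrp)
  show ?thesis
  proof
    fix G :: "'u rpogroup" assume G: "G \<in> Obj RPOGrp"
    then show "cone_model G \<in> Obj (Alg rpo_arity rpo_axioms)"
      by (simp add: rpo_model_iff RPOGrp_def rpo_model_cone_model)
    \<comment> \<open>The identity arrow fixes only the carrier; the inclusion makes it fix the
      second coordinate too.\<close>
    have "pos_cone G \<subseteq> carrier G"
      using G by (simp add: RPOGrp_def right_preordered_group_def submonoid.subset)
    then show "cone_map G (Ident RPOGrp G) = Ident (Alg rpo_arity rpo_axioms) (cone_model G)"
      by (auto simp: Alg_def RPOGrp_def fun_eq_iff cone_map_def elim!: cone_model_cases)
  next
    fix G H :: "'u rpogroup" and f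
    assume G: "G \<in> Obj RPOGrp" and H: "H \<in> Obj RPOGrp" and f: "f \<in> Arr RPOGrp G H"
    then show "cone_map G f \<in> Arr (Alg rpo_arity rpo_axioms) (cone_model G) (cone_model H)"
      by (simp add: RPOGrp_def Alg_def cone_map_hom)
    fix K :: "'u rpogroup" and g
    have "pos_cone G \<subseteq> carrier G"
      using G by (simp add: RPOGrp_def right_preordered_group_def submonoid.subset)
    moreover have "f x \<in> carrier H" if "x \<in> carrier G" for x
      using f that by (auto simp: RPOGrp_def rpo_hom_def hom_def)
    moreover have "f x \<in> pos_cone H" if "x \<in> pos_cone G" for x
      using f that by (auto simp: RPOGrp_def rpo_hom_def)
    ultimately show "cone_map G (Comp RPOGrp G H K g f)
        = Comp (Alg rpo_arity rpo_axioms) (cone_model G) (cone_model H) (cone_model K)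
            (cone_map H g) (cone_map G f)"
      by (auto simp: Alg_def RPOGrp_def compose_def fun_eq_iff cone_map_def subset_iff
          elim!: cone_model_cases)
  qed
qed

section \<open>Unit and counit\<close>

text \<open>The splitting of (P1), with the \<open>M\<^sub>1\<close>-component replaced by its image
  under \<iota> so that it lies in the cone.\<close>

definition unit_map :: "(rpo_op, 'u) algebra \<Rightarrow> 'u \<Rightarrow> 'u" where
  "unit_map A = (\<lambda>a \<in> carrier A. pair (\<pi>0\<^bsub>A\<^esub> a, \<iota>\<^bsub>A\<^esub> a))"

lemma iso_arr_unit_map:
  assumes A: "rpo_model A"
  shows "iso_arr (Alg rpo_arity rpo_axioms) A (cone_model (group_part A)) (unit_map A)"
proof (rule iso_arr_Alg)
  interpret rpo_model A by (rule A)
  interpret B: rpo_model "cone_model (group_part A)"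
    by (rule rpo_model_cone_model[OF right_preordered_group_part])
  show "algebra_of rpo_arity A" "algebra_of rpo_arity (cone_model (group_part A))"
    using A B.rpo_model_axioms by (simp_all add: algebra_of_rpo_iff)
  show "unit_map A \<in> algebra_hom rpo_arity A (cone_model (group_part A))"
    \<comment> \<open>For negation, \<open>pi0_neg\<close> and \<open>iota_neg\<close> compute the
      two coordinates of the image of -a.\<close>
    by (auto simp: algebra_hom_rpo_iff unit_map_def pi0_plus iota_plus iota_eq_zero pi0_eq
        iota_neg pi0_neg)
  show "bij_betw (unit_map A) (carrier A) (carrier (cone_model (group_part A)))"
    unfolding bij_betw_def
  proof
    show "inj_on (unit_map A) (carrier A)"
    proof (rule inj_onI)
      fix a b assume "a \<in> carrier A" "b \<in> carrier A" "unit_map A a = unit_map A b"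
      then show "a = b"
        \<comment> \<open>Equal second coordinates give equal \<open>M\<^sub>1\<close>-components by
          (Inj), and (P1) reassembles the element.\<close>
        using iota_inj[of a b] split[of a] split[of b] by (simp add: unit_map_def)
    qed
    show "unit_map A ` carrier A = carrier (cone_model (group_part A))"
    proof (intro equalityI subsetI)
      fix x assume "x \<in> carrier (cone_model (group_part A))"
      then obtain g c where "x = pair (g, \<iota>\<^bsub>A\<^esub> c)" "g \<in> carrier A" "\<pi>1\<^bsub>A\<^esub> g = o\<^bsub>A\<^esub>" "c \<in> carrier A"
        by (auto elim!: cone_model_cases)
      \<comment> \<open>In this preimage \<open>\<pi>\<^sub>0\<close> kills the second summand and
        \<iota> kills the first.\<close>
      then have "x = unit_map A (g \<boxplus>\<^bsub>A\<^esub> \<pi>1\<^bsub>A\<^esub> c)"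
        by (simp add: unit_map_def pi0_eq iota_eq_zero flip: pi0_plus iota_plus)
      then show "x \<in> unit_map A ` carrier A"
        using \<open>g \<in> carrier A\<close> \<open>c \<in> carrier A\<close> by simp
    qed (auto simp: unit_map_def)
  qed
qed

definition counit_map :: "'u rpogroup \<Rightarrow> 'u \<Rightarrow> 'u" where
  "counit_map G = (\<lambda>x \<in> carrier (group_part (cone_model G)). fst (unpair x))"

text \<open>The condition \<open>\<pi>\<^sub>1\<close> (g, p) = (0, p) = (0, 0) forces p = 0, and 0
  does lie in the cone.\<close>

lemma carrier_group_part_cone_model:
  assumes "right_preordered_group G"
  shows "carrier (group_part (cone_model G)) = (\<lambda>g. pair (g, \<one>\<^bsub>G\<^esub>)) ` carrier G"
proof -
  interpret right_preordered_group G by fact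
  show ?thesis
    by (auto elim!: cone_model_cases)
qed

lemma iso_arr_counit_map:
  assumes G: "right_preordered_group G"
  shows "iso_arr RPOGrp (group_part (cone_model G)) G (counit_map G)"
proof (rule iso_arr_RPOGrp)
  interpret right_preordered_group G by (rule G)
  note carr = carrier_group_part_cone_model[OF G]
  have [simp]: "counit_map G (pair (g, \<one>\<^bsub>G\<^esub>)) = g" if "g \<in> carrier G" for g
    using that by (simp add: counit_map_def)
  \<comment> \<open>Every (p, 0) with p in the cone is \<iota>(g, p) for any g, so first projection
    matches the cones exactly, as \<open>iso_arr_RPOGrp\<close> requires.\<close>
  have cone: "pos_cone (group_part (cone_model G)) = (\<lambda>p. pair (p, \<one>\<^bsub>G\<^esub>)) ` pos_cone G"
    by (force elim!: cone_model_cases simp: carrier_cone_model image_iff)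
  have [simp]: "p \<in> carrier G" if "p \<in> pos_cone G" for p
    using that subset by blast
  show "right_preordered_group (group_part (cone_model G))"
    by (intro rpo_model.right_preordered_group_part rpo_model_cone_model G)
  show "right_preordered_group G" by (rule G)
  show "bij_betw (counit_map G) (carrier (group_part (cone_model G))) (carrier G)"
    unfolding carr by (auto simp: bij_betw_def inj_on_def image_image)
  show "pos_cone G \<subseteq> counit_map G ` pos_cone (group_part (cone_model G))"
    unfolding cone by (auto simp: image_image)
  have "counit_map G \<in> hom (group_part (cone_model G)) G"
    unfolding hom_def carr by auto
  moreover have "counit_map G ` pos_cone (group_part (cone_model G)) \<subseteq> pos_cone G"
    unfolding cone by (auto simp: image_image)
  ultimately show "counit_map G \<in> rpo_hom (group_part (cone_model G)) G"
    by (simp add: rpo_hom_def counit_map_def)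
qed

lemma natural_iso_unit:
  "natural_iso (Alg rpo_arity rpo_axioms) (Alg rpo_arity rpo_axioms) (\<lambda>A. A) (\<lambda>A B h. h)
     (\<lambda>A. cone_model (group_part A))
     (\<lambda>A B h. cone_map (group_part A) (restrict h (carrier (group_part A)))) unit_map"
  unfolding natural_iso_def
proof (intro conjI ballI)
  fix A :: "(rpo_op, 'u) algebra" assume "A \<in> Obj (Alg rpo_arity rpo_axioms)"
  then show "iso_arr (Alg rpo_arity rpo_axioms) A (cone_model (group_part A)) (unit_map A)"
    by (simp add: rpo_model_iff iso_arr_unit_map)
next
  fix A B :: "(rpo_op, 'u) algebra" and h
  assume "A \<in> Obj (Alg rpo_arity rpo_axioms)" "B \<in> Obj (Alg rpo_arity rpo_axioms)"
    and "h \<in> Arr (Alg rpo_arity rpo_axioms) A B"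
  then have A: "rpo_model A" and B: "rpo_model B" and h: "h \<in> algebra_hom rpo_arity A B"
    by (simp_all add: rpo_model_iff) (simp add: Alg_def)
  interpret A: rpo_model A by (rule A)
  \<comment> \<open>Naturality amounts to \<open>h\<close> commuting with
    \<open>\<pi>\<^sub>0\<close> and \<iota>; both values lie in \<open>M\<^sub>0\<close>, where the
    restriction agrees with \<open>h\<close>.\<close>
  have "compose (carrier A) (unit_map B) h = compose (carrier A)
      (cone_map (group_part A) (restrict h (carrier (group_part A)))) (unit_map A)"
    using h by (auto simp: algebra_hom_rpo_iff compose_def fun_eq_iff unit_map_def)
  then show "Comp (Alg rpo_arity rpo_axioms) A B (cone_model (group_part B)) (unit_map B) h
      = Comp (Alg rpo_arity rpo_axioms) A (cone_model (group_part A)) (cone_model (group_part B))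
          (cone_map (group_part A) (restrict h (carrier (group_part A)))) (unit_map A)"
    by (simp add: Alg_def)
qed

lemma natural_iso_counit:
  "natural_iso RPOGrp RPOGrp (\<lambda>G. group_part (cone_model G))
     (\<lambda>G H f. restrict (cone_map G f) (carrier (group_part (cone_model G))))
     (\<lambda>G. G) (\<lambda>G H f. f) counit_map"
  unfolding natural_iso_def
proof (intro conjI ballI)
  fix G :: "'u rpogroup" assume "G \<in> Obj RPOGrp"
  then have "right_preordered_group G"
    by (simp add: RPOGrp_def)
  then show "iso_arr RPOGrp (group_part (cone_model G)) G (counit_map G)"
    by (rule iso_arr_counit_map)
next
  fix G H :: "'u rpogroup" and f
  assume "G \<in> Obj RPOGrp" "H \<in> Obj RPOGrp" and "f \<in> Arr RPOGrp G H"
  then have G: "right_preordered_group G" and H: "right_preordered_group H"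
    and f: "f \<in> rpo_hom G H"
    by (simp_all add: RPOGrp_def)
  interpret G: right_preordered_group G by (rule G)
  interpret H: right_preordered_group H by (rule H)
  \<comment> \<open>Gives f(0) = 0, so that (g, 0) is sent to (f(g), 0), again an element of the
    group part.\<close>
  interpret f: group_hom G H f
    using f by unfold_locales (simp add: rpo_hom_def)
  have "compose (carrier (group_part (cone_model G))) (counit_map H)
        (restrict (cone_map G f) (carrier (group_part (cone_model G))))
      = compose (carrier (group_part (cone_model G))) f (counit_map G)"
    unfolding fun_eq_iff compose_def counit_map_def carrier_group_part_cone_model[OF G]
      carrier_group_part_cone_model[OF H]
    by auto
  then show "Comp RPOGrp (group_part (cone_model G)) (group_part (cone_model H)) H (counit_map H)
        (restrict (cone_map G f) (carrier (group_part (cone_model G))))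
      = Comp RPOGrp (group_part (cone_model G)) G H f (counit_map G)"
    by (simp add: RPOGrp_def)
qed

end

theorem mainTheorem1:
  assumes "infinite (UNIV :: 'u set)"
  shows "equivalent_categories
    (Alg rpo_arity rpo_axioms :: ((rpo_op, 'u) algebra, 'u \<Rightarrow> 'u) cat)
    (RPOGrp :: ('u rpogroup, 'u \<Rightarrow> 'u) cat)"
proof -
  \<comment> \<open>An infinite set is equinumerous with its square.\<close>
  obtain pair :: "'u \<times> 'u \<Rightarrow> 'u" where "bij_betw pair (UNIV \<times> UNIV) UNIV"
    using card_of_Times_same_infinite[OF assms] card_of_ordIso by blast
  then interpret pairing pair
    by unfold_locales (simp add: bij_betw_def)
  let ?C = "Alg rpo_arity rpo_axioms :: ((rpo_op, 'u) algebra, 'u \<Rightarrow> 'u) cat"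
  note F = cat_functor_group_part and G = cat_functor_cone_model
  \<comment> \<open>The unit inverted, to run from the composite to the identity; the counit already
    has the required direction.\<close>
  obtain \<eta> where "natural_iso ?C ?C (\<lambda>A. cone_model (group_part A))
      (\<lambda>A B h. cone_map (group_part A) (restrict h (carrier (group_part A))))
      (\<lambda>A. A) (\<lambda>A B h. h) \<eta>"
    using natural_iso_sym[OF cat_functor_id[OF category_Alg] cat_functor_comp[OF F G]
        natural_iso_unit] by blast
  then show ?thesis
    unfolding equivalent_categories_def
    using category_Alg category_RPOGrp F G natural_iso_counit by blast
qed

end
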